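(* Let $\lambda\in\mathbb{R}$, $x\in\mathbb{R}$, and let $r\ge1$ be an integer. For every integer $n\ge0$, $$D_{n,\lambda}^{(r)}(x)=\sum_{m=0}^{n}\beta_{m,\lambda}^{(r)}(x)\,S_1(n,m).$$
   Context: All generating functions are formal power series in $t$. For $\lambda,y\in\mathbb{R}$, set $(y)_{0,\lambda}=1$ and $(y)_{n,\lambda}=y(y-\lambda)\cdots(y-(n-1)\lambda)$ for $n\ge1$; the formal power series $(1+\lambda u)^{y/\lambda}$ means $\sum_{n\ge0}(y)_{n,\lambda}\frac{u^n}{n!}$ (the usual binomial series for $\lambda\ne0$, and the limit $e^{yu}$ for $\lambda=0$). The higher-order degenerate Bernoulli polynomials $\beta_{n,\lambda}^{(r)}(x)$ (Carlitz) are defined by $\left(\frac{t}{(1+\lambda t)^{1/\lambda}-1}\right)^r(1+\lambda t)^{x/\lambda}=\sum_{n=0}^\infty\beta_{n,\lambda}^{(r)}(x)\frac{t^n}{n!}$. The higher-order degenerate Daehee polynomials of the second kind $D_{n,\lambda}^{(r)}(x)$ are defined by $\left(\frac{\log(1+t)}{(1+\lambda\log(1+t))^{1/\lambda}-1}\right)^r(1+\lambda\log(1+t))^{x/\lambda}=\sum_{n=0}^\infty D_{n,\lambda}^{(r)}(x)\frac{t^n}{n!}$. $S_1(n,l)$ are the (signed) Stirling numbers of the first kind: $x(x-1)\cdots(x-n+1)=\sum_{l=0}^n S_1(n,l)x^l$ (the empty product being $1$ for $n=0$). *)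

theory Defs
  imports
    "HOL-Computational_Algebra.Formal_Power_Series"
    "HOL-Computational_Algebra.Polynomial"
begin

text \<open>Throughout, \<open>lam\<close> is the parameter usually written \<open>\<lambda>\<close>. The product is
  \<open>(y)\<^bsub>n,\<lambda>\<^esub> = y (y - \<lambda>) \<dots> (y - (n-1)\<lambda>)\<close>.\<close>

definition deg_ffact :: "real \<Rightarrow> real \<Rightarrow> nat \<Rightarrow> real" where
  "deg_ffact lam y n = (\<Prod>i<n. y - real i * lam)"

text \<open>The formal power series \<open>(1 + \<lambda>u)\<^bsup>y/\<lambda>\<^esup>\<close> in \<open>u\<close>, including its limit \<open>e\<^bsup>yu\<^esup>\<close> at \<open>\<lambda> = 0\<close>.\<close>

definition deg_exp :: "real \<Rightarrow> real \<Rightarrow> real fps" where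
  "deg_exp lam y = Abs_fps (\<lambda>n. deg_ffact lam y n / fact n)"

lemma deg_exp_0: "deg_exp 0 y = fps_exp y"
  by (simp add: fps_eq_iff deg_exp_def deg_ffact_def)

lemma deg_exp_nonzero:
  assumes "lam \<noteq> 0"
  shows "deg_exp lam y = fps_binomial (y / lam) oo (fps_const lam * fps_X)"
proof (rule fps_ext)
  fix n
  have "(\<Prod>i<n. y - real i * lam) = (\<Prod>i<n. lam * (y / lam - real i))"
    using assms by (intro prod.cong) (auto simp: field_simps)
  then show "fps_nth (deg_exp lam y) n =
      fps_nth (fps_binomial (y / lam) oo (fps_const lam * fps_X)) n"
    by (simp add: deg_exp_def deg_ffact_def fps_compose_linear gbinomial_prod_rev
        prod.distrib lessThan_atLeast0)
qed

text \<open>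
  In the two definitions below, numerator and denominator of the quotient both have zero constant
  term and nonzero linear coefficient, so the truncating division of \<^typ>\<open>real fps\<close> is exact
  (see the lemmas \<open>deg_bernoulli_quotient\<close> and \<open>deg_daehee_quotient\<close>).
  The factor \<open>n!\<close> undoes the exponential normalisation \<open>t\<^sup>n/n!\<close>.
\<close>

definition deg_bernoulli :: "real \<Rightarrow> nat \<Rightarrow> real \<Rightarrow> nat \<Rightarrow> real" where
  "deg_bernoulli lam r x n =
     fact n * fps_nth ((fps_X / (deg_exp lam 1 - 1)) ^ r * deg_exp lam x) n"

text \<open>Here \<open>fps_ln 1\<close> is the series \<open>log (1 + t)\<close>.\<close>

definition deg_daehee :: "real \<Rightarrow> nat \<Rightarrow> real \<Rightarrow> nat \<Rightarrow> real" where
  "deg_daehee lam r x n =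
     fact n * fps_nth ((fps_ln 1 / ((deg_exp lam 1 oo fps_ln 1) - 1)) ^ r
                        * (deg_exp lam x oo fps_ln 1)) n"

lemma deg_bernoulli_gf:
  "Abs_fps (\<lambda>n. deg_bernoulli lam r x n / fact n) =
     (fps_X / (deg_exp lam 1 - 1)) ^ r * deg_exp lam x"
  by (simp add: fps_eq_iff deg_bernoulli_def)

lemma deg_daehee_gf:
  "Abs_fps (\<lambda>n. deg_daehee lam r x n / fact n) =
     (fps_ln 1 / ((deg_exp lam 1 oo fps_ln 1) - 1)) ^ r * (deg_exp lam x oo fps_ln 1)"
  by (simp add: fps_eq_iff deg_daehee_def)

lemma deg_bernoulli_quotient:
  "fps_X / (deg_exp lam 1 - 1) * (deg_exp lam 1 - 1) = fps_X"
proof -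
  have "subdegree (deg_exp lam 1 - 1) = 1"
    by (rule subdegreeI) (auto simp: deg_exp_def deg_ffact_def)
  then have "deg_exp lam 1 - 1 dvd fps_X"
    by (subst fps_dvd_iff) auto
  then show ?thesis by simp
qed

lemma deg_daehee_quotient:
  "fps_ln 1 / ((deg_exp lam 1 oo fps_ln 1) - 1) * ((deg_exp lam 1 oo fps_ln 1) - 1) = fps_ln 1"
proof -
  have 1: "subdegree ((deg_exp lam 1 oo fps_ln 1) - 1) = 1"
    by (rule subdegreeI) (auto simp: deg_exp_def deg_ffact_def fps_compose_nth fps_ln_nth)
  have 2: "subdegree (fps_ln 1 :: real fps) = 1"
    by (rule subdegreeI) (auto simp: fps_ln_nth)
  have "((deg_exp lam 1 oo fps_ln 1) - 1) dvd fps_ln 1"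
    using 1 2 by (subst fps_dvd_iff) auto
  then show ?thesis by simp
qed

text \<open>
  Signed Stirling numbers of the first kind, as the coefficients of the polynomial
  \<open>x (x - 1) \<dots> (x - n + 1)\<close>.  (The library's \<open>stirling\<close> is the unsigned version.)
\<close>

definition signed_stirling1 :: "nat \<Rightarrow> nat \<Rightarrow> real" where
  "signed_stirling1 n l = coeff (\<Prod>i<n. [:- real i, 1:]) l"

lemma signed_stirling1_ffact:
  "(\<Prod>i<n. x - real i) = (\<Sum>l=0..n. signed_stirling1 n l * x ^ l)"
proof -
  define p where "p = (\<Prod>i<n. [:- real i, 1:])"
  have "degree p \<le> n"
    using degree_prod_sum_le[of "{..<n}" "\<lambda>i. [:- real i, 1:]"] by (simp add: p_def)
  then have "p = (\<Sum>l\<le>n. monom (coeff p l) l)"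
    by (simp add: poly_as_sum_of_monoms')
  then have "poly p x = (\<Sum>l\<le>n. coeff p l * x ^ l)"
    by (metis (no_types, lifting) poly_monom poly_sum sum.cong)
  then show ?thesis
    by (simp add: p_def signed_stirling1_def poly_prod atMost_atLeast0)
qed

end

theory Submission
  imports Defs
begin

text \<open>
  Writing \<open>L = log (1 + t)\<close>, the Daehee generating function is the Bernoulli one composed with \<open>L\<close>,
  so it remains to expand the powers \<open>L\<^sup>m\<close>: the equation \<open>(1 + t) (L\<^sup>m)' = m L\<^bsup>m-1\<^esup>\<close> is
  the Stirling recurrence for the coefficients of \<open>L\<^sup>m / m!\<close>.
\<close>

lemma signed_stirling1_0: "signed_stirling1 0 m = (if m = 0 then 1 else 0)"
  by (simp add: signed_stirling1_def)

text \<open>The new factor \<open>[:- real n, 1:]\<close> shifts the coefficients by one and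
  subtracts \<open>real n\<close> times the old ones.\<close>

lemma signed_stirling1_Suc:
  "signed_stirling1 (Suc n) m =
     (if m = 0 then 0 else signed_stirling1 n (m - 1)) - real n * signed_stirling1 n m"
  by (cases m) (simp_all add: signed_stirling1_def mult.commute[of _ "[:- real n, 1:]"])

lemma fps_ln_power_nth_Suc:
  "real (Suc n) * fps_nth (fps_ln 1 ^ m :: real fps) (Suc n) =
     real m * fps_nth (fps_ln 1 ^ (m - 1)) n - real n * fps_nth (fps_ln 1 ^ m) n"
proof -
  let ?L = "fps_ln 1 :: real fps"
  have "(1 + fps_X) * fps_deriv ?L = 1"
    by (simp add: fps_ln_deriv fps_divide_unit inverse_mult_eq_1')
  then have "(1 + fps_X) * fps_deriv (?L ^ m) = of_nat m * ?L ^ (m - 1)"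
    by (simp add: fps_deriv_power mult_ac flip: fps_of_nat)
  \<comment> \<open>In degree \<open>n\<close>, the term \<open>fps_X\<close> times the derivative
    contributes \<open>real n\<close> times the coefficient of degree \<open>n\<close>. At
    \<open>m = 0\<close> the truncated exponent \<open>m - 1\<close> is harmless, as its factor is
    zero.\<close>
  from arg_cong[OF this, of "\<lambda>f. fps_nth f n"] show ?thesis
    by (cases n) (simp_all add: algebra_simps flip: fps_of_nat)
qed

lemma fps_ln_power_nth:
  "fact n * fps_nth (fps_ln 1 ^ m :: real fps) n = fact m * signed_stirling1 n m"
proof (induction n arbitrary: m)
  case 0
  show ?case
    by (simp add: signed_stirling1_0 fps_nth_power_0)
next
  case (Suc n)
  have "fact (Suc n) * fps_nth (fps_ln 1 ^ m :: real fps) (Suc n) =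
      real m * (fact n * fps_nth (fps_ln 1 ^ (m - 1)) n)
        - real n * (fact n * fps_nth (fps_ln 1 ^ m) n)"
    using arg_cong[OF fps_ln_power_nth_Suc[of n m], of "\<lambda>z. fact n * z"]
    by (simp add: algebra_simps)
  also have "\<dots> = fact m * signed_stirling1 (Suc n) m"
    unfolding Suc.IH by (cases m) (simp_all add: signed_stirling1_Suc algebra_simps)
  finally show ?case .
qed

text \<open>Composition with a series without constant term respects products, so it carries the
  exact division by \<open>deg_exp lam 1 - 1\<close> to one by its composite; cancelling that
  nonzero divisor identifies the quotients.\<close>

lemma deg_daehee_quotient_eq_compose:
  "fps_ln 1 / ((deg_exp lam 1 oo fps_ln 1) - 1) = (fps_X / (deg_exp lam 1 - 1)) oo fps_ln 1"
proof -
  let ?D = "(deg_exp lam 1 oo fps_ln 1) - 1"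
  let ?Q = "fps_X / (deg_exp lam 1 - 1)"
  have L0: "fps_nth (fps_ln 1 :: real fps) 0 = 0"
    by simp
  have "(?Q oo fps_ln 1) * ?D = (?Q * (deg_exp lam 1 - 1)) oo fps_ln 1"
    by (simp add: fps_compose_mult_distrib[OF L0] fps_compose_sub_distrib
        del: fps_divide_times_eq)
  also have "\<dots> = fps_ln 1"
    by (simp only: deg_bernoulli_quotient fps_X_fps_compose_startby0[OF L0])
  finally have eq: "(?Q oo fps_ln 1) * ?D = fps_ln 1" .
  \<comment> \<open>A zero divisor \<open>?D\<close> would make the logarithm zero, yet its linear
    coefficient is not.\<close>
  have "fps_nth (fps_ln 1 :: real fps) 1 \<noteq> 0"
    by (simp add: fps_ln_nth)
  then have "?D \<noteq> 0"
    using eq by (metis fps_zero_nth mult_zero_right)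
  then show ?thesis
    using eq by (metis deg_daehee_quotient mult_right_cancel)
qed

theorem theorem2p7:
  fixes lam x :: real and r n :: nat
  assumes "r \<ge> 1"
  shows "deg_daehee lam r x n =
           (\<Sum>m=0..n. deg_bernoulli lam r x m * signed_stirling1 n m)"
proof -
  define B where "B = (fps_X / (deg_exp lam 1 - 1)) ^ r * deg_exp lam x"
  have L0: "fps_nth (fps_ln 1 :: real fps) 0 = 0"
    by simp
  \<comment> \<open>Every factor is now a composite with the logarithm, which can be pulled out of
    the power and the product.\<close>
  have "deg_daehee lam r x n = fact n * fps_nth (B oo fps_ln 1) n"
    unfolding deg_daehee_def B_def deg_daehee_quotient_eq_compose
    by (simp only: fps_compose_mult_distrib[OF L0] fps_compose_power[OF L0])
  also have "\<dots> = (\<Sum>m=0..n. fps_nth B m * (fact n * fps_nth (fps_ln 1 ^ m) n))"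
    by (simp add: fps_compose_nth sum_distrib_left mult_ac)
  also have "\<dots> = (\<Sum>m=0..n. deg_bernoulli lam r x m * signed_stirling1 n m)"
    unfolding fps_ln_power_nth by (simp add: deg_bernoulli_def B_def mult_ac)
  finally show ?thesis .
qed

end
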